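(* Let $n,p,q,r$ be positive integers. Then $$ \sum_{\ell=0}^n \ell^{p}H_{n-\ell}^{(q,r)}=\sum_{y=0}^{p+r} c(p,r,n,y)\, H_{n-1}^{(q-y)}, $$ where $$ c(p,r,n,y)=\sum_{\substack{m+t=y\\ 0 \le m\le r-1\\ 0 \le t \le p+r-m}}\ \sum_{k=\max\{0,t-p-1\}}^{r-1-m} a_{7}(p+k,n,t)\, a_{8}(r,m,k,n), $$ with $$ a_{6}(\ell,n,t)=\frac{1}{(\ell+1)!}\sum_{i=t}^{\ell+1} s(\ell+1,i) \binom{i}{t} (-1)^{t} (n+1)^{i-t},\qquad a_{7}(p,n,t)=\sum_{\ell=1}^{p} S(p,\ell)\,\ell!\, a_{6}(\ell,n,t), $$ $$ a_{8}(r,m,k,n)=\sum_{j=k}^{r-1-m}\hat{a}(r,m,j) \binom{j}{k} (-1)^{k} n^{j-k}. $$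
   Context: For every integer $m$ (possibly zero or negative) and $N\ge 0$, $H_N^{(m)}=\sum_{j=1}^N j^{-m}$ (so $H_0^{(m)}=0$). Generalized hyperharmonic numbers: $H_N^{(q,1)}=H_N^{(q)}$ and $H_N^{(q,r)}=\sum_{j=1}^N H_j^{(q,r-1)}$ for $r\ge2$, $N\ge0$. $S(p,\ell)$ are Stirling numbers of the second kind ($x^p=\sum_\ell S(p,\ell)x(x-1)\cdots(x-\ell+1)$) and $s(k,i)$ the signed Stirling numbers of the first kind ($x(x-1)\cdots(x-k+1)=\sum_i s(k,i)x^i$). Empty sums are $0$; $0^0=1$. Bernoulli numbers $B_m^{+}$ are defined by $\frac{x}{1-e^{-x}}=\sum_{m\ge0}B_m^{+}\frac{x^m}{m!}$. The numbers $\hat a(r,m,j)$, for $r\ge1$, $0\le m\le r-1$, $0\le j\le r-1-m$, are defined recursively by $\hat a(1,0,0)=1$ and, for $r\ge1$: $\hat{a}(r+1,r,0)=-\sum_{m=0}^{r-1} \hat{a}(r,m,r-m-1)\frac{1}{r-m}$; $\hat{a}(r+1,m,\ell)=\sum_{j=\ell-1}^{r-1-m} \frac{\hat{a}(r,m,j)}{j+1} \binom{j+1}{j-\ell+1}B_{j-\ell+1}^{+}$ for $0\le m\le r-1$, $1\le \ell\le r-m$; $\hat{a}(r+1,m,0)=-\sum_{y=0}^{m} \sum_{j=\max\{0, m-y-1\}}^{r-1-y}\hat{a}(r,y,j)D(r,m,j,y)$ for $0\le m\le r-1$, where $D(r,m,j,y)=\sum_{\ell=\max\{0, m-y-1\}}^{j}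 \frac{1}{j+1} \binom{j+1}{j-\ell}B_{j-\ell}^{+}\binom{\ell+1}{m-y}(-1)^{1+\ell-m+y}$. *)

theory Defs
  imports
    "HOL-Computational_Algebra.Polynomial"
    "HOL-Computational_Algebra.Formal_Power_Series"
    "HOL-Combinatorics.Stirling"
begin

definition gen_harm :: "int \<Rightarrow> nat \<Rightarrow> real" where
  "gen_harm m N = (\<Sum>j=1..N. real j powi (- m))"

text \<open>\<open>hyperharm q r N\<close> is $H_N^{(q,r)}$; the order \<open>r = 0\<close> is outside the domain
  of the definition and gets a dummy value.\<close>

fun hyperharm :: "int \<Rightarrow> nat \<Rightarrow> nat \<Rightarrow> real" where
  "hyperharm q 0 N = 0"
| "hyperharm q (Suc 0) N = gen_harm q N"
| "hyperharm q (Suc (Suc r)) N = (\<Sum>j=1..N. hyperharm q (Suc r) j)"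

text \<open>The library's \<^const>\<open>stirling\<close> is unsigned.\<close>

definition signed_stirling :: "nat \<Rightarrow> nat \<Rightarrow> int" where
  "signed_stirling k i = coeff (\<Prod>j<k. [:- int j, 1:]) i"

lemma signed_stirling_expansion:
  fixes x :: int
  shows "(\<Prod>j<k. x - int j) = (\<Sum>i\<le>k. signed_stirling k i * x ^ i)"
proof -
  let ?P = "\<Prod>j<k. [:- int j, 1:]"
  have "degree ?P \<le> (\<Sum>j<k. degree [:- int j, 1:])"
    using degree_prod_sum_le[of "{..<k}" "\<lambda>j. [:- int j, 1:]"] by (simp add: o_def)
  then have deg: "degree ?P \<le> k" by simp
  have "poly ?P x = (\<Sum>i\<le>degree ?P. coeff ?P i * x ^ i)"
    by (rule poly_altdef)
  also have "\<dots> = (\<Sum>i\<le>k. coeff ?P i * x ^ i)"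
  proof (rule sum.mono_neutral_left)
    show "\<forall>i\<in>{..k} - {..degree ?P}. coeff ?P i * x ^ i = 0"
      by (auto intro: coeff_eq_0)
  qed (use deg in auto)
  finally have "poly ?P x = (\<Sum>i\<le>k. coeff ?P i * x ^ i)" .
  then show ?thesis
    by (simp add: signed_stirling_def poly_prod)
qed

lemma Stirling_expansion:
  fixes x :: "'a::comm_ring_1"
  shows "x ^ p = (\<Sum>l\<le>p. of_nat (Stirling p l) * (\<Prod>i<l. x - of_nat i))"
proof (induction p)
  case 0
  show ?case by simp
next
  case (Suc p)
  define F where "F = (\<lambda>l. \<Prod>i<l. x - of_nat i)"
  define S where "S = (\<lambda>l. of_nat (Stirling p l) :: 'a)"
  have step: "x * F l = F (Suc l) + of_nat l * F l" for l
    by (simp add: F_def algebra_simps)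
  have "x ^ Suc p = x * (\<Sum>l\<le>p. S l * F l)"
    using Suc by (simp add: F_def S_def)
  also have "\<dots> = (\<Sum>l\<le>p. S l * (x * F l))"
    by (simp add: sum_distrib_left mult_ac)
  also have "\<dots> = (\<Sum>l\<le>p. S l * F (Suc l)) + (\<Sum>l\<le>p. of_nat l * S l * F l)"
    by (simp only: step distrib_left sum.distrib) (simp add: mult_ac)
  also have "(\<Sum>l\<le>p. of_nat l * S l * F l) = (\<Sum>l\<le>Suc p. of_nat l * S l * F l)"
    by (simp add: S_def)
  also have "\<dots> = (\<Sum>l\<le>p. of_nat (Suc l) * S (Suc l) * F (Suc l))"
    by (simp only: sum.atMost_Suc_shift) simp
  also have "(\<Sum>l\<le>p. S l * F (Suc l)) + \<dots>
      = (\<Sum>l\<le>p. of_nat (Stirling (Suc p) (Suc l)) * F (Suc l))"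
    by (simp add: S_def sum.distrib[symmetric] algebra_simps)
  also have "\<dots> = (\<Sum>l\<le>Suc p. of_nat (Stirling (Suc p) l) * F l)"
    by (simp only: sum.atMost_Suc_shift) simp
  finally show ?case by (simp only: F_def)
qed

definition bernoulli_plus :: "nat \<Rightarrow> real" where
  "bernoulli_plus m = fact m * fps_nth (fps_X / (1 - fps_exp (- 1))) m"

text \<open>The quotient of formal power series above is an exact division.\<close>

lemma bernoulli_plus_gf:
  "Abs_fps (\<lambda>m. bernoulli_plus m / fact m) * (1 - fps_exp (- 1)) = (fps_X :: real fps)"
proof -
  let ?g = "1 - fps_exp (- 1) :: real fps"
  have g1: "fps_nth ?g 1 \<noteq> 0" by simp
  then have "?g \<noteq> 0" by (metis fps_zero_nth)
  moreover have "subdegree ?g \<le> 1" using g1 by (rule subdegree_leI)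
  ultimately have "?g dvd fps_X" by (subst fps_dvd_iff) auto
  moreover have "Abs_fps (\<lambda>m. bernoulli_plus m / fact m) = fps_X / ?g"
    by (simp add: bernoulli_plus_def fps_eq_iff)
  ultimately show ?thesis by simp
qed

text \<open>In the definitions below the truncated subtractions \<open>m - y - 1\<close> and \<open>t - p - 1\<close> on
  natural numbers serve as lower summation bounds \<open>max {0, m - y - 1}\<close> and
  \<open>max {0, t - p - 1}\<close>; no other subtraction is truncated on the index ranges used.\<close>

definition D_coeff :: "nat \<Rightarrow> nat \<Rightarrow> nat \<Rightarrow> nat \<Rightarrow> real" where
  "D_coeff r m j y = (\<Sum>l = m - y - 1..j.
     1 / real (j + 1) * real ((j + 1) choose (j - l)) * bernoulli_plus (j - l)
     * real ((l + 1) choose (m - y)) * (- 1) ^ (1 + l + y - m))"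

text \<open>\<open>a_hat r m j\<close> is $\hat a(r,m,j)$, extended by \<open>0\<close> outside the index range
  \<open>1 \<le> r\<close>, \<open>m \<le> r - 1\<close>, \<open>j \<le> r - 1 - m\<close>.\<close>

fun a_hat :: "nat \<Rightarrow> nat \<Rightarrow> nat \<Rightarrow> real" where
  "a_hat 0 m l = 0"
| "a_hat (Suc 0) m l = (if m = 0 \<and> l = 0 then 1 else 0)"
| "a_hat (Suc (Suc r')) m l =
    (let r = Suc r' in
     if m = r \<and> l = 0 then
       - (\<Sum>i = 0..r - 1. a_hat (Suc r') i (r - i - 1) * (1 / real (r - i)))
     else if m \<le> r - 1 \<and> 1 \<le> l \<and> l \<le> r - m then
       (\<Sum>j = l - 1..r - 1 - m. a_hat (Suc r') m j / real (j + 1)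
          * real ((j + 1) choose (j + 1 - l)) * bernoulli_plus (j + 1 - l))
     else if m \<le> r - 1 \<and> l = 0 then
       - (\<Sum>y = 0..m. \<Sum>j = m - y - 1..r - 1 - y. a_hat (Suc r') y j * D_coeff r m j y)
     else 0)"

lemma a_hat_base: "a_hat 1 0 0 = 1"
  by simp

lemma a_hat_rec_top:
  assumes "r \<ge> 1"
  shows "a_hat (r + 1) r 0 = - (\<Sum>m = 0..r - 1. a_hat r m (r - m - 1) * (1 / real (r - m)))"
  using assms by (cases r) (simp_all add: Let_def)

lemma a_hat_rec_pos:
  assumes "r \<ge> 1" "m \<le> r - 1" "1 \<le> l" "l \<le> r - m"
  shows "a_hat (r + 1) m l = (\<Sum>j = l - 1..r - 1 - m.
    a_hat r m j / real (j + 1) * real ((j + 1) choose (j + 1 - l)) * bernoulli_plus (j + 1 - l))"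
  using assms by (cases r) (simp_all add: Let_def)

lemma a_hat_rec_zero:
  assumes "r \<ge> 1" "m \<le> r - 1"
  shows "a_hat (r + 1) m 0 =
    - (\<Sum>y = 0..m. \<Sum>j = m - y - 1..r - 1 - y. a_hat r y j * D_coeff r m j y)"
  using assms by (cases r) (simp_all add: Let_def)

definition a6 :: "nat \<Rightarrow> nat \<Rightarrow> nat \<Rightarrow> real" where
  "a6 l n t = 1 / fact (l + 1) * (\<Sum>i = t..l + 1.
     real_of_int (signed_stirling (l + 1) i) * real (i choose t) * (- 1) ^ t * real (n + 1) ^ (i - t))"

definition a7 :: "nat \<Rightarrow> nat \<Rightarrow> nat \<Rightarrow> real" where
  "a7 p n t = (\<Sum>l = 1..p. real (Stirling p l) * fact l * a6 l n t)"

definition a8 :: "nat \<Rightarrow> nat \<Rightarrow> nat \<Rightarrow> nat \<Rightarrow> real" where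
  "a8 r m k n = (\<Sum>j = k..r - 1 - m. a_hat r m j * real (j choose k) * (- 1) ^ k * real n ^ (j - k))"

definition c_coeff :: "nat \<Rightarrow> nat \<Rightarrow> nat \<Rightarrow> nat \<Rightarrow> real" where
  "c_coeff p r n y =
    (\<Sum>(m, t) \<in> {(m, t). m + t = y \<and> m \<le> r - 1 \<and> t \<le> p + r - m}.
       \<Sum>k = t - p - 1..r - 1 - m. a7 (p + k) n t * a8 r m k n)"

end

theory Submission
  imports Defs
begin

text \<open>
  By induction on \<open>r\<close>, $H_N^{(q,r)} = \sum_{i=1}^N i^{-q} F_r(N,i)$ with the polynomial kernel
  $F_r(N,i) = \sum_{m,j} \hat a(r,m,j) N^j i^m$: the recursion for $\hat a$ is the coefficientwise
  form of $F_{r+1}(N,i) = \sum_{M=i}^N F_r(M,i)$, where the power sums over \<open>M\<close> are evaluated by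
  Faulhaber's formula at \<open>N\<close> and at \<open>i - 1\<close>. Re-expanding $F_r(n-\ell,i)$ in powers of $\ell$
  produces \<open>a8\<close>. Exchanging the order of summation leaves the inner sums
  $\sum_{v=0}^{n-i} v^{p+k}$, which expand in falling factorials, hence in powers of \<open>i\<close> with
  coefficients \<open>a7\<close>; they vanish at \<open>i = n\<close>, so only $H_{n-1}$ occurs.
\<close>

section \<open>Faulhaber's formula from the generating function of the Bernoulli numbers\<close>

definition faulhaber_coeff :: "nat \<Rightarrow> nat \<Rightarrow> real" where
  "faulhaber_coeff j l = 1 / real (j + 1) * real ((j + 1) choose (j - l)) * bernoulli_plus (j - l)"

text \<open>Telescoping: multiplication by \<open>fps_exp (- 1)\<close> turns the summand for
  \<open>M\<close> into the one for \<open>M - 1\<close>.\<close>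

lemma fps_exp_geometric_sum:
  "(1 - fps_exp (- 1)) * (\<Sum>M=1..N. fps_exp (real M)) = fps_exp (real N) - (1 :: real fps)"
proof (induction N)
  case (Suc N)
  have "fps_exp (- 1) * fps_exp (real (Suc N)) = fps_exp (real N)"
    by (simp flip: fps_exp_add_mult)
  then show ?case using Suc by (simp add: algebra_simps)
qed simp

text \<open>Multiply the telescoped sum by the series \<open>?B\<close> of x/(1 - e^(-x)) and
  compare the coefficients of x^(j+1) in x * (e^x + ... + e^(Nx)) = \<open>?B\<close> * (e^(Nx) -
  1).\<close>

lemma sum_powers_faulhaber:
  "(\<Sum>M=1..N. real M ^ j) = (\<Sum>l\<le>j. faulhaber_coeff j l * real N ^ (l + 1))"
proof -
  let ?B = "Abs_fps (\<lambda>m. bernoulli_plus m / fact m)"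
  let ?S = "\<Sum>M=1..N. fps_exp (real M)"
  have "fps_X * ?S = ?B * ((1 - fps_exp (- 1)) * ?S)"
    by (metis bernoulli_plus_gf mult.assoc)
  also have "\<dots> = ?B * (fps_exp (real N) - 1)"
    by (simp only: fps_exp_geometric_sum)
  finally have "fps_nth (fps_X * ?S) (Suc j) = fps_nth (?B * (fps_exp (real N) - 1)) (Suc j)"
    by simp
  moreover have "fps_nth (fps_X * ?S) (Suc j) = (\<Sum>M=1..N. real M ^ j) / fact j"
    by (simp add: fps_sum_nth sum_divide_distrib)
  \<comment> \<open>The term \<open>i = Suc j\<close> of the convolution drops out, since e^(Nx) - 1
    has constant coefficient 0.\<close>
  moreover have "fps_nth (?B * (fps_exp (real N) - 1)) (Suc j)
      = (\<Sum>i=0..j. bernoulli_plus i / fact i * (real N ^ (Suc j - i) / fact (Suc j - i)))"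
    unfolding fps_mult_nth by (simp add: sum.atLeast0_atMost_Suc mult.commute)
  moreover have "\<dots> = (\<Sum>l=0..j. bernoulli_plus (j - l) / fact (j - l)
      * (real N ^ (l + 1) / fact (l + 1)))"
    by (rule sum.reindex_bij_witness[of _ "\<lambda>i. j - i" "\<lambda>i. j - i"]) (auto simp: Suc_diff_le)
  ultimately have "(\<Sum>M=1..N. real M ^ j) = fact j * (\<Sum>l\<le>j. bernoulli_plus (j - l)
      / fact (j - l) * (real N ^ (l + 1) / fact (l + 1)))"
    by (simp add: field_simps atLeast0AtMost)
  also have "\<dots> = (\<Sum>l\<le>j. faulhaber_coeff j l * real N ^ (l + 1))"
    unfolding sum_distrib_left
  proof (rule sum.cong)
    fix l assume "l \<in> {..j}"
    then have "real ((j + 1) choose (j - l)) = fact (j + 1) / (fact (j - l) * fact (l + 1))"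
      by (subst binomial_fact) (auto simp: Suc_diff_le)
    then show "fact j * (bernoulli_plus (j - l) / fact (j - l) * (real N ^ (l + 1) / fact (l + 1)))
        = faulhaber_coeff j l * real N ^ (l + 1)"
      by (simp add: faulhaber_coeff_def field_simps del: of_nat_Suc binomial_Suc_Suc)
  qed simp
  finally show ?thesis .
qed

text \<open>Expand each power of \<open>i - 1\<close> in Faulhaber's formula binomially and collect
  powers of \<open>i\<close>. Writing the second index as \<open>y + d\<close> anticipates a further
  factor \<open>i ^ y\<close>, after which that index is the full exponent of
  \<open>i\<close>.\<close>

lemma sum_powers_pred_eq_D_coeff:
  assumes "i \<ge> 1"
  shows "(\<Sum>M=1..i - 1. real M ^ j) = (\<Sum>d\<le>j + 1. D_coeff r (y + d) j y * real i ^ d)"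
proof -
  let ?g = "\<lambda>l d. faulhaber_coeff j l * real ((l + 1) choose d) * (- 1) ^ (l + 1 - d) * real i ^ d"
  have "real (i - 1) = real i + (- 1)" using assms by simp
  then have "(\<Sum>M=1..i - 1. real M ^ j) = (\<Sum>l\<le>j. \<Sum>d\<le>l + 1. ?g l d)"
    unfolding sum_powers_faulhaber
    by (simp only: binomial_ring sum_distrib_left) (simp add: mult_ac)
  \<comment> \<open>The condition \<open>d <= l + 1\<close> is the lower bound \<open>d - 1\<close>
    on \<open>l\<close>, truncation included.\<close>
  also have "\<dots> = (\<Sum>d\<le>j + 1. \<Sum>l=d - 1..j. ?g l d)"
    by (subst (1 2) sum.Sigma, simp, simp, simp, simp)
      (rule sum.reindex_bij_witness[of _ "\<lambda>(d, l). (l, d)" "\<lambda>(l, d). (d, l)"]; force)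
  also have "\<dots> = (\<Sum>d\<le>j + 1. D_coeff r (y + d) j y * real i ^ d)"
    unfolding D_coeff_def faulhaber_coeff_def sum_distrib_right
    by (intro sum.cong refl) auto
  finally show ?thesis .
qed

section \<open>The kernel of the hyperharmonic numbers and its recursion in \<open>r\<close>\<close>

text \<open>The half-open bounds describe the triangle \<open>m + j < r\<close>; unlike
  \<open>r - 1 - m\<close>, the bound \<open>r - m\<close> gives an empty range of \<open>j\<close>
  at \<open>m = r\<close>.\<close>

definition hyperharm_kernel :: "nat \<Rightarrow> nat \<Rightarrow> nat \<Rightarrow> real" where
  "hyperharm_kernel r N i = (\<Sum>m<r. \<Sum>j<r - m. a_hat r m j * real N ^ j * real i ^ m)"

lemma a_hat_Suc_pos:
  assumes "m < r" "l < r - m"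
  shows "a_hat (Suc r) m (Suc l) = (\<Sum>j=l..<r - m. a_hat r m j * faulhaber_coeff j l)"
proof -
  have "{l..r - 1 - m} = {l..<r - m}" using assms by auto
  moreover have "j + 1 - Suc l = j - l" for j by simp
  ultimately show ?thesis
    using a_hat_rec_pos[of r m "Suc l"] assms
    by (simp add: faulhaber_coeff_def mult.assoc del: binomial_Suc_Suc)
qed

lemma bernoulli_plus_0: "bernoulli_plus 0 = 1"
proof -
  have "fps_nth (Abs_fps (\<lambda>m. bernoulli_plus m / fact m) * (1 - fps_exp (- 1))) 1 = 1"
    unfolding bernoulli_plus_gf by simp
  then show ?thesis by (simp add: fps_mult_nth)
qed

text \<open>Both summation bounds equal \<open>r - 1 - y\<close>, and the one remaining term
  involves only the Bernoulli number of index 0.\<close>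

lemma D_coeff_top:
  assumes "y < r"
  shows "D_coeff r r (r - 1 - y) y = 1 / real (r - y)"
proof -
  have "r - y - 1 = r - 1 - y" "r - 1 - y + 1 = r - y" "1 + (r - 1 - y) + y - r = 0"
    using assms by auto
  then show ?thesis
    by (simp add: D_coeff_def bernoulli_plus_0)
qed

text \<open>Unites the two recursion rules with last index 0: at \<open>m = r\<close> the range of
  \<open>j\<close> shrinks to \<open>r - 1 - y\<close>, where \<open>D_coeff_top\<close> recovers
  the separate rule for \<open>a_hat (r + 1) r 0\<close>.\<close>

lemma a_hat_Suc_zero:
  assumes "r \<ge> 1" "m \<le> r"
  shows "a_hat (Suc r) m 0
    = - (\<Sum>y\<in>{y. y \<le> m \<and> y < r}. \<Sum>j=m - y - 1..<r - y. a_hat r y j * D_coeff r m j y)"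
proof (cases "m = r")
  case True
  have "{y. y \<le> m \<and> y < r} = {0..r - 1}" using True assms by auto
  moreover have "(\<Sum>j=m - y - 1..<r - y. a_hat r y j * D_coeff r m j y)
      = a_hat r y (r - y - 1) * (1 / real (r - y))" if "y \<in> {0..r - 1}" for y
  proof -
    have "{m - y - 1..<r - y} = {r - 1 - y}" using True that assms by auto
    then show ?thesis using True that assms D_coeff_top[of y r] by simp
  qed
  ultimately show ?thesis
    using a_hat_rec_top[OF assms(1)] True by simp
next
  case False
  then have "{y. y \<le> m \<and> y < r} = {0..m}" using assms by auto
  moreover have "{m - y - 1..<r - y} = {m - y - 1..r - 1 - y}" if "y \<in> {0..m}" for y
    using that assms False by auto
  ultimately show ?thesis
    using a_hat_rec_zero[of r m] assms False by simp
qed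

text \<open>Each power sum from \<open>i\<close> to \<open>N\<close> is its value up to
  \<open>N\<close> minus its value up to \<open>i - 1\<close>. The former has no constant term in
  \<open>N\<close> and yields the coefficients with positive last index; the latter is free of
  \<open>N\<close> and yields those with last index 0.\<close>

lemma sum_hyperharm_kernel:
  assumes "r \<ge> 1" "1 \<le> i" "i \<le> N"
  shows "(\<Sum>M=i..N. hyperharm_kernel r M i) = hyperharm_kernel (Suc r) N i"
proof -
  let ?S = "\<lambda>N j. \<Sum>M=1..N. real M ^ j"
  have split: "(\<Sum>M=i..N. real M ^ j) = ?S N j - ?S (i - 1) j" for j
  proof -
    have "{1..N} = {1..i - 1} \<union> {i..N}" using assms by auto
    then have "?S N j = ?S (i - 1) j + (\<Sum>M=i..N. real M ^ j)"
      using assms by (simp add: sum.union_disjoint[symmetric] del: One_nat_def)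
    then show ?thesis by simp
  qed
  have lhs: "(\<Sum>M=i..N. hyperharm_kernel r M i)
      = (\<Sum>m<r. \<Sum>j<r - m. a_hat r m j * ?S N j * real i ^ m)
        - (\<Sum>m<r. \<Sum>j<r - m. a_hat r m j * ?S (i - 1) j * real i ^ m)"
  proof -
    have "(\<Sum>M=i..N. hyperharm_kernel r M i)
        = (\<Sum>m<r. \<Sum>M=i..N. \<Sum>j<r - m. a_hat r m j * real M ^ j * real i ^ m)"
      unfolding hyperharm_kernel_def by (rule sum.swap)
    also have "\<dots> = (\<Sum>m<r. \<Sum>j<r - m. \<Sum>M=i..N. a_hat r m j * real M ^ j * real i ^ m)"
      by (intro sum.cong refl sum.swap)
    also have "\<dots> = (\<Sum>m<r. \<Sum>j<r - m. a_hat r m j * (\<Sum>M=i..N. real M ^ j) * real i ^ m)"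
      by (simp add: sum_distrib_left sum_distrib_right)
    finally show ?thesis
      unfolding split by (simp add: algebra_simps sum_subtractf)
  qed
  have pos: "(\<Sum>m<r. \<Sum>j<r - m. a_hat r m j * ?S N j * real i ^ m)
      = (\<Sum>m<r. \<Sum>l<r - m. a_hat (Suc r) m (Suc l) * real N ^ Suc l * real i ^ m)"
  proof (rule sum.cong)
    fix m assume "m \<in> {..<r}"
    let ?g = "\<lambda>j l. a_hat r m j * faulhaber_coeff j l * real N ^ Suc l * real i ^ m"
    have "(\<Sum>j<r - m. a_hat r m j * ?S N j * real i ^ m) = (\<Sum>j<r - m. \<Sum>l\<le>j. ?g j l)"
      unfolding sum_powers_faulhaber by (simp add: sum_distrib_left sum_distrib_right mult_ac)
    also have "\<dots> = (\<Sum>l<r - m. \<Sum>j=l..<r - m. ?g j l)"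
      by (subst (1 2) sum.Sigma, simp, simp, simp, simp)
        (rule sum.reindex_bij_witness[of _ "\<lambda>(d, l). (l, d)" "\<lambda>(l, d). (d, l)"]; force)
    also have "\<dots> = (\<Sum>l<r - m. a_hat (Suc r) m (Suc l) * real N ^ Suc l * real i ^ m)"
      using \<open>m \<in> {..<r}\<close> by (simp add: a_hat_Suc_pos sum_distrib_right)
    finally show "(\<Sum>j<r - m. a_hat r m j * ?S N j * real i ^ m) = \<dots>" .
  qed simp
  have zero: "(\<Sum>m<r. \<Sum>j<r - m. a_hat r m j * ?S (i - 1) j * real i ^ m)
      = - (\<Sum>m\<le>r. a_hat (Suc r) m 0 * real i ^ m)"
  proof -
    let ?g = "\<lambda>y j m. a_hat r y j * D_coeff r m j y * real i ^ m"
    have "(\<Sum>y<r. \<Sum>j<r - y. a_hat r y j * ?S (i - 1) j * real i ^ y)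
        = (\<Sum>y<r. \<Sum>j<r - y. \<Sum>d\<le>j + 1. ?g y j (y + d))"
    proof (intro sum.cong refl)
      fix y j
      show "a_hat r y j * ?S (i - 1) j * real i ^ y = (\<Sum>d\<le>j + 1. ?g y j (y + d))"
        unfolding sum_powers_pred_eq_D_coeff[OF assms(2), of j r y] sum_distrib_left
          sum_distrib_right
        by (simp only: power_add mult_ac)
    qed
    \<comment> \<open>Collect by the exponent \<open>m = y + d\<close> of \<open>i\<close>; it stays
      at most \<open>r\<close> because \<open>d <= j + 1 <= r - y\<close>.\<close>
    also have "\<dots> = (\<Sum>m\<le>r. \<Sum>y\<in>{y. y \<le> m \<and> y < r}. \<Sum>j=m - y - 1..<r - y. ?g y j m)"
      by (simp add: sum.Sigma split_def del: One_nat_def)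
        (rule sum.reindex_bij_witness[of _ "\<lambda>(m, y, j). (y, j, m - y)"
            "\<lambda>(y, j, d). (y + d, y, j)"]; force)
    also have "\<dots> = - (\<Sum>m\<le>r. a_hat (Suc r) m 0 * real i ^ m)"
      using assms by (simp add: a_hat_Suc_zero sum_distrib_right sum_negf)
    finally show ?thesis .
  qed
  have "hyperharm_kernel (Suc r) N i = (\<Sum>m\<le>r. (a_hat (Suc r) m 0 * real i ^ m
      + (\<Sum>l<r - m. a_hat (Suc r) m (Suc l) * real N ^ Suc l * real i ^ m)))"
    unfolding hyperharm_kernel_def lessThan_Suc_atMost
    by (rule sum.cong) (simp_all add: Suc_diff_le sum.lessThan_Suc_shift
        del: a_hat.simps power_Suc sum.lessThan_Suc)
  \<comment> \<open>At \<open>m = r\<close> the inner sum is empty, so only the entry with last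
    index 0 remains there.\<close>
  also have "\<dots> = (\<Sum>m\<le>r. a_hat (Suc r) m 0 * real i ^ m)
      + (\<Sum>m<r. \<Sum>l<r - m. a_hat (Suc r) m (Suc l) * real N ^ Suc l * real i ^ m)"
    unfolding sum.distrib by (simp add: lessThan_Suc_atMost[symmetric] del: a_hat.simps power_Suc)
  finally show ?thesis
    unfolding lhs pos zero by simp
qed

lemma hyperharm_eq_kernel:
  "r \<ge> 1 \<Longrightarrow> hyperharm q r N = (\<Sum>i=1..N. real i powi (- q) * hyperharm_kernel r N i)"
proof (induction r arbitrary: N rule: nat_induct_at_least)
  case base
  \<comment> \<open>The kernel of order 1 is the constant 1.\<close>
  show ?case by (simp add: gen_harm_def hyperharm_kernel_def)
next
  case (Suc r)
  have "hyperharm q (Suc r) N = (\<Sum>M=1..N. hyperharm q r M)"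
    using Suc.hyps by (cases r) simp_all
  also have "\<dots> = (\<Sum>M=1..N. \<Sum>i=1..M. real i powi (- q) * hyperharm_kernel r M i)"
    by (simp only: Suc.IH)
  also have "\<dots> = (\<Sum>i=1..N. \<Sum>M=i..N. real i powi (- q) * hyperharm_kernel r M i)"
    by (subst (1 2) sum.Sigma, simp, simp, simp, simp)
      (rule sum.reindex_bij_witness[of _ "\<lambda>(d, l). (l, d)" "\<lambda>(l, d). (d, l)"]; force)
  also have "\<dots> = (\<Sum>i=1..N. real i powi (- q) * hyperharm_kernel (Suc r) N i)"
    using Suc.hyps by (simp add: sum_distrib_left[symmetric] sum_hyperharm_kernel)
  finally show ?case .
qed

section \<open>Re-expansion of the kernel at \<open>n - l\<close> in powers of
  \<open>l\<close>\<close>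

lemma hyperharm_kernel_diff:
  assumes "l \<le> n"
  shows "hyperharm_kernel r (n - l) i = (\<Sum>m<r. \<Sum>k<r - m. a8 r m k n * real l ^ k * real i ^ m)"
  unfolding hyperharm_kernel_def
proof (rule sum.cong)
  fix m assume m: "m \<in> {..<r}"
  let ?g = "\<lambda>j k. a_hat r m j * real (j choose k) * (- 1) ^ k * real n ^ (j - k)
      * real l ^ k * real i ^ m"
  have "real (n - l) ^ j
      = (\<Sum>k\<le>j. real (j choose k) * (- 1) ^ k * real n ^ (j - k) * real l ^ k)" for j
  proof -
    have "real (n - l) = - real l + real n" using assms by simp
    then show ?thesis
      by (simp only: binomial_ring power_minus[of "real l"]) (simp add: mult_ac)
  qed
  then have "(\<Sum>j<r - m. a_hat r m j * real (n - l) ^ j * real i ^ m)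
      = (\<Sum>j<r - m. \<Sum>k\<le>j. ?g j k)"
    by (simp add: sum_distrib_left sum_distrib_right mult_ac)
  also have "\<dots> = (\<Sum>k<r - m. \<Sum>j=k..r - 1 - m. ?g j k)"
    by (subst (1 2) sum.Sigma, simp, simp, simp, simp)
      (rule sum.reindex_bij_witness[of _ "\<lambda>(d, l). (l, d)" "\<lambda>(l, d). (d, l)"]; force)
  also have "\<dots> = (\<Sum>k<r - m. a8 r m k n * real l ^ k * real i ^ m)"
    by (simp add: a8_def sum_distrib_right)
  finally show "(\<Sum>j<r - m. a_hat r m j * real (n - l) ^ j * real i ^ m) = \<dots>" .
qed simp

section \<open>Power sums up to \<open>n - i\<close> as polynomials in \<open>i\<close>\<close>

lemma prod_falling_eq_fact_binomial:
  "(\<Prod>i<l. real v - real i) = fact l * real (v choose l)"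
  by (simp add: binomial_gbinomial gbinomial_prod_rev atLeast0LessThan)

text \<open>Up to the factor \<open>fact (l + 1)\<close> the binomial coefficient is a falling
  factorial of n + 1 - i. Signed Stirling numbers turn it into powers of n + 1 - i, which are
  expanded binomially in \<open>i\<close>.\<close>

lemma binomial_eq_sum_a6:
  assumes "i \<le> n"
  shows "real (Suc (n - i) choose Suc l) = (\<Sum>t\<le>l + 1. a6 l n t * real i ^ t)"
proof -
  define x where "x = int (Suc (n - i))"
  have x: "real_of_int x = - real i + real (n + 1)" using assms by (simp add: x_def)
  let ?g = "\<lambda>k t. real_of_int (signed_stirling (l + 1) k) * real (k choose t) * (- 1) ^ t
      * real (n + 1) ^ (k - t) * real i ^ t"
  have "fact (l + 1) * real (Suc (n - i) choose (l + 1)) = (\<Prod>j<l + 1. real_of_int x - real j)"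
    unfolding prod_falling_eq_fact_binomial[symmetric] by (simp add: x_def)
  also have "\<dots> = real_of_int (\<Prod>j<l + 1. x - int j)"
    by simp
  also have "\<dots> = (\<Sum>k\<le>l + 1. real_of_int (signed_stirling (l + 1) k) * real_of_int x ^ k)"
    unfolding signed_stirling_expansion by simp
  also have "\<dots> = (\<Sum>k\<le>l + 1. \<Sum>t\<le>k. ?g k t)"
    unfolding x binomial_ring power_minus[of "real i"] by (simp add: sum_distrib_left mult_ac)
  also have "\<dots> = (\<Sum>t\<le>l + 1. \<Sum>k=t..l + 1. ?g k t)"
    by (subst (1 2) sum.Sigma, simp, simp, simp, simp)
      (rule sum.reindex_bij_witness[of _ "\<lambda>(d, l). (l, d)" "\<lambda>(l, d). (d, l)"]; force)
  also have "\<dots> = fact (l + 1) * (\<Sum>t\<le>l + 1. a6 l n t * real i ^ t)"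
    unfolding a6_def sum_distrib_left sum_distrib_right
    by (intro sum.cong refl) (simp add: field_simps del: fact_Suc)
  finally show ?thesis by (simp del: fact_Suc sum.atMost_Suc binomial_Suc_Suc)
qed

text \<open>Allows the range of \<open>t\<close>, which depends on \<open>l\<close>, to be extended
  to one common range.\<close>

lemma a6_eq_0: "t > l + 1 \<Longrightarrow> a6 l n t = 0"
  by (simp add: a6_def)

text \<open>In the falling factorial basis the sum over \<open>v\<close> is evaluated by the
  hockey-stick identity, which gives the binomial coefficients expanded by
  \<open>a6\<close>.\<close>

lemma sum_powers_eq_a7:
  assumes "s \<ge> 1" "i \<le> n"
  shows "(\<Sum>v\<le>n - i. real v ^ s) = (\<Sum>t\<le>s + 1. a7 s n t * real i ^ t)"
proof -
  have "(\<Sum>v\<le>n - i. real v ^ s)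
      = (\<Sum>v\<le>n - i. \<Sum>l\<le>s. real (Stirling s l) * (fact l * real (v choose l)))"
    unfolding prod_falling_eq_fact_binomial[symmetric] by (subst Stirling_expansion) (rule refl)
  also have "\<dots> = (\<Sum>l\<le>s. \<Sum>v\<le>n - i. real (Stirling s l) * (fact l * real (v choose l)))"
    by (rule sum.swap)
  also have "\<dots> = (\<Sum>l\<le>s. real (Stirling s l) * fact l * real (\<Sum>v\<le>n - i. v choose l))"
    by (simp add: sum_distrib_left mult_ac)
  also have "\<dots> = (\<Sum>l\<le>s. real (Stirling s l) * fact l * real (Suc (n - i) choose Suc l))"
    by (simp only: sum_choose_upper)
  \<comment> \<open>The term \<open>l = 0\<close> vanishes because \<open>Stirling s 0 = 0\<close>
    for \<open>s >= 1\<close>.\<close>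
  also have "\<dots> = (\<Sum>l=1..s. real (Stirling s l) * fact l * real (Suc (n - i) choose Suc l))"
  proof (rule sum.mono_neutral_right)
    show "\<forall>l\<in>{..s} - {1..s}. real (Stirling s l) * fact l * real (Suc (n - i) choose Suc l) = 0"
      using assms(1) by (cases s) (auto simp: not_le)
  qed auto
  also have "\<dots> = (\<Sum>l=1..s. real (Stirling s l) * fact l * (\<Sum>t\<le>s + 1. a6 l n t * real i ^ t))"
  proof (intro sum.cong refl arg_cong2[where f = "(*)"])
    fix l assume "l \<in> {1..s}"
    then show "real (Suc (n - i) choose Suc l) = (\<Sum>t\<le>s + 1. a6 l n t * real i ^ t)"
      unfolding binomial_eq_sum_a6[OF assms(2)]
      by (intro sum.mono_neutral_left) (auto simp: a6_eq_0)
  qed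
  also have "\<dots> = (\<Sum>t\<le>s + 1. \<Sum>l=1..s. real (Stirling s l) * fact l * (a6 l n t * real i ^ t))"
    unfolding sum_distrib_left by (rule sum.swap)
  also have "\<dots> = (\<Sum>t\<le>s + 1. a7 s n t * real i ^ t)"
    unfolding a7_def sum_distrib_right by (simp only: mult.assoc)
  finally show ?thesis .
qed

lemma weighted_power_sum_eq_gen_harm:
  assumes "n \<ge> 1" "s \<ge> 1"
  shows "(\<Sum>i=1..n. real i powi (int m - q) * (\<Sum>v\<le>n - i. real v ^ s))
    = (\<Sum>t\<le>s + 1. a7 s n t * gen_harm (q - int (m + t)) (n - 1))"
proof -
  have "(\<Sum>i=1..n. real i powi (int m - q) * (\<Sum>v\<le>n - i. real v ^ s))
      = (\<Sum>i=1..n - 1. real i powi (int m - q) * (\<Sum>v\<le>n - i. real v ^ s))"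
    using assms by (cases n) auto
  also have "\<dots> = (\<Sum>i=1..n - 1. \<Sum>t\<le>s + 1. a7 s n t * real i powi (- (q - int (m + t))))"
  proof (rule sum.cong)
    fix i assume i: "i \<in> {1..n - 1}"
    have "real i powi (int m - q) * real i ^ t = real i powi (- (q - int (m + t)))" for t
    proof -
      have "- (q - int (m + t)) = (int m - q) + int t" by simp
      \<comment> \<open>Exponents of \<open>powi\<close> add up for a nonzero base, which
        \<open>i >= 1\<close> provides.\<close>
      then show ?thesis using i by (simp only: power_int_add) (simp add: power_int_add)
    qed
    moreover have "i \<le> n" using i by auto
    ultimately show "real i powi (int m - q) * (\<Sum>v\<le>n - i. real v ^ s)
        = (\<Sum>t\<le>s + 1. a7 s n t * real i powi (- (q - int (m + t))))"
      unfolding sum_powers_eq_a7[OF assms(2) \<open>i \<le> n\<close>] sum_distrib_left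
      by (intro sum.cong refl) (metis mult.left_commute)
  qed simp
  also have "\<dots> = (\<Sum>t\<le>s + 1. a7 s n t * gen_harm (q - int (m + t)) (n - 1))"
    unfolding gen_harm_def sum_distrib_left by (rule sum.swap)
  finally show ?thesis .
qed

section \<open>Exchange of summations and collection by the order of the harmonic numbers\<close>

theorem theorem7:
  fixes n p q r :: nat
  assumes "n \<ge> 1" and "p \<ge> 1" and "q \<ge> 1" and "r \<ge> 1"
  shows "(\<Sum>l = 0..n. real l ^ p * hyperharm (int q) r (n - l)) =
    (\<Sum>y = 0..p + r. c_coeff p r n y * gen_harm (int q - int y) (n - 1))"
proof -
  let ?h = "\<lambda>m k i l. a8 r m k n * (real i powi (int m - int q) * real l ^ (p + k))"
  let ?u = "\<lambda>m t k. a7 (p + k) n t * a8 r m k n * gen_harm (int q - int (m + t)) (n - 1)"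
  have "(\<Sum>l = 0..n. real l ^ p * hyperharm (int q) r (n - l))
      = (\<Sum>l=0..n. \<Sum>i=1..n - l. \<Sum>m<r. \<Sum>k<r - m. ?h m k i l)"
  proof (rule sum.cong)
    fix l assume l: "l \<in> {0..n}"
    have "real i powi (- int q) * real i ^ m = real i powi (int m - int q)" if "i \<ge> 1" for i m
      using that by (simp add: power_int_diff power_int_minus field_simps)
    then have h: "?h m k i l
        = real l ^ p * (real i powi (- int q) * (a8 r m k n * real l ^ k * real i ^ m))"
      if "i \<ge> 1" for i m k
      using that by (simp add: power_add flip: mult.assoc)
    have "l \<le> n" using l by simp
    show "real l ^ p * hyperharm (int q) r (n - l)
        = (\<Sum>i=1..n - l. \<Sum>m<r. \<Sum>k<r - m. ?h m k i l)"
      unfolding hyperharm_eq_kernel[OF assms(4)] hyperharm_kernel_diff[OF \<open>l \<le> n\<close>]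
        sum_distrib_left
      by (intro sum.cong refl h[symmetric]) simp
  qed simp
  \<comment> \<open>Both sides run over \<open>i >= 1\<close> with
    \<open>i + l <= n\<close>.\<close>
  also have "\<dots> = (\<Sum>i=1..n. \<Sum>l\<le>n - i. \<Sum>m<r. \<Sum>k<r - m. ?h m k i l)"
    by (subst (1 4) sum.Sigma, simp, simp, simp, simp)
      (rule sum.reindex_bij_witness[of _ "\<lambda>(d, l). (l, d)" "\<lambda>(l, d). (d, l)"]; force)
  also have "\<dots> = (\<Sum>m<r. \<Sum>k<r - m. \<Sum>i=1..n. \<Sum>l\<le>n - i. ?h m k i l)"
  proof -
    have "(\<Sum>l\<le>n - i. \<Sum>m<r. \<Sum>k<r - m. ?h m k i l)
        = (\<Sum>m<r. \<Sum>k<r - m. \<Sum>l\<le>n - i. ?h m k i l)" for i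
      by (subst sum.swap) (intro sum.cong refl sum.swap)
    then have "(\<Sum>i=1..n. \<Sum>l\<le>n - i. \<Sum>m<r. \<Sum>k<r - m. ?h m k i l)
        = (\<Sum>i=1..n. \<Sum>m<r. \<Sum>k<r - m. \<Sum>l\<le>n - i. ?h m k i l)"
      by simp
    also have "\<dots> = (\<Sum>m<r. \<Sum>k<r - m. \<Sum>i=1..n. \<Sum>l\<le>n - i. ?h m k i l)"
      by (subst sum.swap) (intro sum.cong refl sum.swap)
    finally show ?thesis .
  qed
  also have "\<dots> = (\<Sum>m<r. \<Sum>k<r - m. a8 r m k n
      * (\<Sum>t\<le>p + k + 1. a7 (p + k) n t * gen_harm (int q - int (m + t)) (n - 1)))"
  proof (intro sum.cong refl)
    fix m k
    have "p + k \<ge> 1" using assms(2) by simp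
    show "(\<Sum>i=1..n. \<Sum>l\<le>n - i. ?h m k i l) = a8 r m k n
        * (\<Sum>t\<le>p + k + 1. a7 (p + k) n t * gen_harm (int q - int (m + t)) (n - 1))"
      unfolding weighted_power_sum_eq_gen_harm[OF assms(1) \<open>p + k \<ge> 1\<close>, symmetric]
      by (simp only: sum_distrib_left)
  qed
  also have "\<dots> = (\<Sum>m<r. \<Sum>k<r - m. \<Sum>t\<le>p + k + 1. ?u m t k)"
    by (simp add: sum_distrib_left mult_ac del: sum.atMost_Suc)
  \<comment> \<open>Group by \<open>y = m + t\<close>. The bound \<open>t <= p + k + 1\<close>
    becomes the truncated lower bound on \<open>k\<close>, and with \<open>k <= r - 1 - m\<close> it
    gives \<open>t <= p + r - m\<close>, hence \<open>y <= p + r\<close>.\<close>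
  also have "\<dots> = (\<Sum>y=0..p + r. \<Sum>(m, t)\<in>{(m, t). m + t = y \<and> m \<le> r - 1 \<and> t \<le> p + r - m}.
      \<Sum>k=t - p - 1..r - 1 - m. ?u m t k)"
  proof -
    have fin: "finite {(m, t). m + t = y \<and> m \<le> r - 1 \<and> t \<le> p + r - m}" for y
      by (rule finite_subset[of _ "{..y} \<times> {..y}"]) auto
    show ?thesis
      using assms(4)
      by (simp add: sum.Sigma split_def fin[unfolded split_def] del: sum.atMost_Suc One_nat_def)
        (rule sum.reindex_bij_witness[of _ "\<lambda>(y, (m, t), k). (m, k, t)"
            "\<lambda>(m, k, t). (m + t, (m, t), k)"]; force)
  qed
  also have "\<dots> = (\<Sum>y = 0..p + r. c_coeff p r n y * gen_harm (int q - int y) (n - 1))"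
    unfolding c_coeff_def sum_distrib_right by (intro sum.cong refl) (auto simp: sum_distrib_right)
  finally show ?thesis .
qed

end
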